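(* Let $\mathfrak{n}$ be a nonempty, proper, convex subset of $\mathbb{C}$ and let $\Omega$ be a solvable sesquilinear form on a dense subspace $\mathcal{D}$ of a complex Hilbert space $\mathcal{H}$, with numerical range $\mathfrak{n}_\Omega\subseteq\mathfrak{n}$ and associated operator $T$. If a sesquilinear form $\Upsilon\in\mathfrak{P}(\Omega)$ has numerical range $\mathfrak{n}_\Upsilon$ such that $\mathfrak{n}\cap(-\mathfrak{n}_\Upsilon)=\varnothing$, then $T$ is $\mathfrak{n}$-maximal. In particular, if there exists $\lambda\in\mathfrak{n}^c$ such that $-\lambda\iota\in\mathfrak{P}(\Omega)$, then $T$ is $\mathfrak{n}$-maximal.
   Context: $\mathcal{H}$ is a complex Hilbert space with inner product $\langle\cdot|\cdot\rangle$ and norm $\|\cdot\|$; $\mathcal{D}$ is a dense subspace of $\mathcal{H}$; $\iota$ denotes the form $\iota(\xi,\eta)=\langle\xi|\eta\rangle$. $E^c=\mathbb{C}\setminus E$ for $E\subseteq\mathbb{C}$. An operator $T$ on $\mathcal{H}$ is a linear map from a linear subspace $D(T)\subseteq\mathcal{H}$ to $\mathcal{H}$, and $T\subseteq T'$ means that $T'$ extends $T$. Numerical ranges: $\mathfrak{n}_T=\{\langle T\xi|\xi\rangle:\xi\in D(T),\|\xi\|=1\}$ for an operator, and $\mathfrak{n}_\Omega=\{\Omega(\xi,\xi):\xi\in\mathcal{D},\|\xi\|=1\}$ for a sesquilinear form $\Omega$ on $\mathcal{D}$ (and similarly for forms on $\mathcal{H}$). $\mathfrak{n}$-maximality: for a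 nonempty, convex, proper subset $\mathfrak{n}$ of $\mathbb{C}$, $T$ is $\mathfrak{n}$-maximal if $\mathfrak{n}_T\subseteq\mathfrak{n}$ and whenever $T\subseteq T'$ and $\mathfrak{n}_{T'}\subseteq\mathfrak{n}$, then $T=T'$. q-closed forms: a sesquilinear form $\Omega$ on $\mathcal{D}$ is q-closed with respect to a norm $\|\cdot\|_\Omega$ on $\mathcal{D}$ if (1) there is $\alpha>0$ with $\|\xi\|\le\alpha\|\xi\|_\Omega$ for all $\xi\in\mathcal{D}$; (2) $\mathcal{E}_\Omega:=\mathcal{D}[\|\cdot\|_\Omega]$ (the space $\mathcal{D}$ with norm $\|\cdot\|_\Omega$) is a reflexive Banach space; (3) there is $\beta>0$ with $|\Omega(\xi,\eta)|\le\beta\|\xi\|_\Omega\|\eta\|_\Omega$ for all $\xi,\eta\in\mathcal{D}$. Solvable forms: let $\Omega$ be q-closed with respect to $\|\cdot\|_\Omega$ and let $\mathcal{E}_\Omega^\times$ be the conjugate dual of $\mathcal{E}_\Omega$ (bounded conjugate-linear functionals $\Lambda$, with action written $\langle\Lambda|\eta\rangle$). $\mathfrak{P}(\Omega)$ is the set of bounded sesquilinear forms $\Upsilon$ on $\mathcal{H}$ such that (1) if $\xi\in\mathcal{D}$ and $(\Omega+\Upsilon)(\xi,\eta)=0$ for all $\eta\in\mathcal{D}$, then $\xi=0$; (2) for every $\Lambda\in\mathcal{E}_\Omega^\times$ there is $\xi\in\mathcal{E}_\Omega$ with $\langle\Lambda|\eta\rangle=(\Omega+\Upsilon)(\xi,\eta)$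 for all $\eta\in\mathcal{E}_\Omega$. $\Omega$ is solvable with respect to $\|\cdot\|_\Omega$ if $\mathfrak{P}(\Omega)\ne\varnothing$; it is solvable if this holds for some norm $\|\cdot\|_\Omega$, and $\mathfrak{P}(\Omega)$ is then taken with respect to that norm. Associated operator: $D(T)=\{\xi\in\mathcal{D}:\exists\chi\in\mathcal{H},\ \Omega(\xi,\eta)=\langle\chi|\eta\rangle\ \forall\eta\in\mathcal{D}\}$ and $T\xi=\chi$. *)

theory Defs
  imports "HOL-Analysis.Analysis"
begin

section \<open>Complex Hilbert spaces\<close>

text \<open>The inner product is linear in the first and conjugate-linear in the second argument.
  Positive definiteness is a consequence of the last axiom and the norm axioms of
  \<^class>\<open>real_normed_vector\<close>.\<close>

class complex_inner = real_normed_vector +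
  fixes scaleC :: "complex \<Rightarrow> 'a \<Rightarrow> 'a" (infixr "*\<^sub>C" 75)
    and cinner :: "'a \<Rightarrow> 'a \<Rightarrow> complex"
  assumes scaleC_add_right: "a *\<^sub>C (x + y) = a *\<^sub>C x + a *\<^sub>C y"
    and scaleC_add_left: "(a + b) *\<^sub>C x = a *\<^sub>C x + b *\<^sub>C x"
    and scaleC_scaleC: "a *\<^sub>C b *\<^sub>C x = (a * b) *\<^sub>C x"
    and scaleC_one: "1 *\<^sub>C x = x"
    and scaleR_scaleC: "r *\<^sub>R x = complex_of_real r *\<^sub>C x"
    and cinner_add_left: "cinner (x + y) z = cinner x z + cinner y z"
    and cinner_scaleC_left: "cinner (a *\<^sub>C x) y = a * cinner x y"
    and cinner_commute: "cinner x y = cnj (cinner y x)"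
    and cinner_self: "cinner x x = complex_of_real ((norm x)\<^sup>2)"

class chilbert_space = complex_inner + complete_space

instantiation complex :: chilbert_space
begin

definition "scaleC_complex a (x::complex) = a * x"
definition "cinner_complex x (y::complex) = x * cnj y"

instance
proof
  fix a b x y z :: complex and r :: real
  show "cinner x x = complex_of_real ((norm x)\<^sup>2)"
    by (simp only: cinner_complex_def complex_norm_square)
qed (simp_all add: scaleC_complex_def cinner_complex_def algebra_simps scaleR_conv_of_real)

end

interpretation complex_vector: vector_space "scaleC :: complex \<Rightarrow> 'a \<Rightarrow> 'a::complex_inner"
  by unfold_locales
    (simp_all add: scaleC_add_right scaleC_add_left scaleC_scaleC scaleC_one)


section \<open>Linear maps and forms on subspaces\<close>

definition clinear_on ::
    "'a::complex_inner set \<Rightarrow> ('a \<Rightarrow> 'b::complex_inner) \<Rightarrow> bool" where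
  "clinear_on V f \<longleftrightarrow>
     (\<forall>x\<in>V. \<forall>y\<in>V. f (x + y) = f x + f y) \<and> (\<forall>a. \<forall>x\<in>V. f (a *\<^sub>C x) = a *\<^sub>C f x)"

definition conj_linear_on :: "'a::complex_inner set \<Rightarrow> ('a \<Rightarrow> complex) \<Rightarrow> bool" where
  "conj_linear_on V f \<longleftrightarrow>
     (\<forall>x\<in>V. \<forall>y\<in>V. f (x + y) = f x + f y) \<and> (\<forall>a. \<forall>x\<in>V. f (a *\<^sub>C x) = cnj a * f x)"

definition sesquilinear_on :: "'a::complex_inner set \<Rightarrow> ('a \<Rightarrow> 'a \<Rightarrow> complex) \<Rightarrow> bool" where
  "sesquilinear_on D \<Omega> \<longleftrightarrow>
     (\<forall>\<eta>\<in>D. clinear_on D (\<lambda>\<xi>. \<Omega> \<xi> \<eta>)) \<and> (\<forall>\<xi>\<in>D. conj_linear_on D (\<lambda>\<eta>. \<Omega> \<xi> \<eta>))"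

definition form_num_range :: "'a::complex_inner set \<Rightarrow> ('a \<Rightarrow> 'a \<Rightarrow> complex) \<Rightarrow> complex set" where
  "form_num_range D \<Omega> = {\<Omega> \<xi> \<xi> | \<xi>. \<xi> \<in> D \<and> norm \<xi> = 1}"

definition bounded_sesquilinear :: "('a::complex_inner \<Rightarrow> 'a \<Rightarrow> complex) \<Rightarrow> bool" where
  "bounded_sesquilinear \<Upsilon> \<longleftrightarrow>
     sesquilinear_on UNIV \<Upsilon> \<and> (\<exists>K. \<forall>\<xi> \<eta>. cmod (\<Upsilon> \<xi> \<eta>) \<le> K * norm \<xi> * norm \<eta>)"


section \<open>Operators\<close>

text \<open>An operator is a partial map \<open>T\<close> with domain \<^term>\<open>dom T\<close>; extension of operators is then
  \<^term>\<open>T \<subseteq>\<^sub>m T'\<close>.\<close>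

definition is_operator :: "('a::complex_inner \<rightharpoonup> 'a) \<Rightarrow> bool" where
  "is_operator T \<longleftrightarrow> complex_vector.subspace (dom T) \<and> clinear_on (dom T) (\<lambda>\<xi>. the (T \<xi>))"

definition op_num_range :: "('a::complex_inner \<rightharpoonup> 'a) \<Rightarrow> complex set" where
  "op_num_range T = {cinner (the (T \<xi>)) \<xi> | \<xi>. \<xi> \<in> dom T \<and> norm \<xi> = 1}"

definition n_maximal :: "complex set \<Rightarrow> ('a::complex_inner \<rightharpoonup> 'a) \<Rightarrow> bool" where
  "n_maximal \<nn> T \<longleftrightarrow>
     is_operator T \<and> op_num_range T \<subseteq> \<nn> \<and>
     (\<forall>T'. is_operator T' \<and> T \<subseteq>\<^sub>m T' \<and> op_num_range T' \<subseteq> \<nn> \<longrightarrow> T = T')"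

text \<open>The vector \<open>\<zeta>\<close> below is unique when \<open>D\<close> is dense.\<close>

definition associated_operator ::
    "'a::complex_inner set \<Rightarrow> ('a \<Rightarrow> 'a \<Rightarrow> complex) \<Rightarrow> ('a \<rightharpoonup> 'a)" where
  "associated_operator D \<Omega> = (\<lambda>\<xi>.
     if \<xi> \<in> D \<and> (\<exists>\<zeta>. \<forall>\<eta>\<in>D. \<Omega> \<xi> \<eta> = cinner \<zeta> \<eta>)
     then Some (THE \<zeta>. \<forall>\<eta>\<in>D. \<Omega> \<xi> \<eta> = cinner \<zeta> \<eta>) else None)"


section \<open>Reflexive Banach spaces carried by a subspace\<close>

text \<open>The normed space \<open>V[N]\<close>: the subspace \<open>V\<close> with a norm \<open>N\<close> of its own, unrelated a priori to
  the ambient one. Values of \<open>N\<close> outside \<open>V\<close> are irrelevant.\<close>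

definition norm_on :: "'a::complex_inner set \<Rightarrow> ('a \<Rightarrow> real) \<Rightarrow> bool" where
  "norm_on V N \<longleftrightarrow>
     (\<forall>x\<in>V. 0 \<le> N x \<and> (N x = 0 \<longleftrightarrow> x = 0)) \<and>
     (\<forall>a. \<forall>x\<in>V. N (a *\<^sub>C x) = cmod a * N x) \<and>
     (\<forall>x\<in>V. \<forall>y\<in>V. N (x + y) \<le> N x + N y)"

text \<open>\<^locale>\<open>Metric_space\<close> wants a distance that is symmetric and nonnegative on the whole type, hence
  the case distinction.\<close>

definition norm_dist :: "'a::complex_inner set \<Rightarrow> ('a \<Rightarrow> real) \<Rightarrow> 'a \<Rightarrow> 'a \<Rightarrow> real" where
  "norm_dist V N x y = (if x \<in> V \<and> y \<in> V then N (x - y) else 0)"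

lemma Metric_space_norm_dist:
  assumes V: "complex_vector.subspace V" and N: "norm_on V N"
  shows "Metric_space V (norm_dist V N)"
proof
  have diff: "x - y \<in> V" if "x \<in> V" "y \<in> V" for x y
    using complex_vector.subspace_diff[OF V that] .
  have nonneg: "0 \<le> N x" and eq0: "N x = 0 \<longleftrightarrow> x = 0" and hom: "N (a *\<^sub>C x) = cmod a * N x"
    if "x \<in> V" for x a
    using N that by (simp_all add: norm_on_def)
  have tri: "N (x + y) \<le> N x + N y" if "x \<in> V" "y \<in> V" for x y
    using N that by (simp add: norm_on_def)
  show "0 \<le> norm_dist V N x y" for x y
    by (simp add: norm_dist_def nonneg diff)
  show "norm_dist V N x y = norm_dist V N y x" for x y
    using hom[OF diff, of x y "-1"] by (simp add: norm_dist_def)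
  show "norm_dist V N x y = 0 \<longleftrightarrow> x = y" if "x \<in> V" "y \<in> V" for x y
    using that by (simp add: norm_dist_def eq0 diff)
  show "norm_dist V N x z \<le> norm_dist V N x y + norm_dist V N y z"
    if "x \<in> V" "y \<in> V" "z \<in> V" for x y z
    using tri[OF diff diff, of x y y z] that by (simp add: norm_dist_def)
qed

definition banach_on :: "'a::complex_inner set \<Rightarrow> ('a \<Rightarrow> real) \<Rightarrow> bool" where
  "banach_on V N \<longleftrightarrow>
     complex_vector.subspace V \<and> norm_on V N \<and> Metric_space.mcomplete V (norm_dist V N)"

definition bounded_on :: "'a set \<Rightarrow> ('a \<Rightarrow> real) \<Rightarrow> ('a \<Rightarrow> complex) \<Rightarrow> bool" where
  "bounded_on V N f \<longleftrightarrow> (\<exists>K. \<forall>x\<in>V. cmod (f x) \<le> K * N x)"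

text \<open>Functionals on \<open>V\<close> are extended by \<open>0\<close> outside \<open>V\<close>, so that equality of functions is equality
  of functionals.\<close>

definition dual_on :: "'a::complex_inner set \<Rightarrow> ('a \<Rightarrow> real) \<Rightarrow> ('a \<Rightarrow> complex) set" where
  "dual_on V N = {f. clinear_on V f \<and> bounded_on V N f \<and> (\<forall>x. x \<notin> V \<longrightarrow> f x = 0)}"

definition conj_dual_on :: "'a::complex_inner set \<Rightarrow> ('a \<Rightarrow> real) \<Rightarrow> ('a \<Rightarrow> complex) set" where
  "conj_dual_on V N = {f. conj_linear_on V f \<and> bounded_on V N f \<and> (\<forall>x. x \<notin> V \<longrightarrow> f x = 0)}"

definition dual_norm :: "'a set \<Rightarrow> ('a \<Rightarrow> real) \<Rightarrow> ('a \<Rightarrow> complex) \<Rightarrow> real" where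
  "dual_norm V N f = (SUP x\<in>{x \<in> V. N x \<le> 1}. cmod (f x))"

text \<open>The canonical embedding of \<open>V[N]\<close> into its bidual is onto.\<close>

definition reflexive_banach_on :: "'a::complex_inner set \<Rightarrow> ('a \<Rightarrow> real) \<Rightarrow> bool" where
  "reflexive_banach_on V N \<longleftrightarrow>
     banach_on V N \<and>
     (\<forall>F :: ('a \<Rightarrow> complex) \<Rightarrow> complex.
        (\<forall>f\<in>dual_on V N. \<forall>g\<in>dual_on V N. F (\<lambda>x. f x + g x) = F f + F g) \<and>
        (\<forall>a. \<forall>f\<in>dual_on V N. F (\<lambda>x. a * f x) = a * F f) \<and>
        bounded_on (dual_on V N) (dual_norm V N) F
        \<longrightarrow> (\<exists>x\<in>V. \<forall>f\<in>dual_on V N. F f = f x))"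


section \<open>Solvable forms\<close>

definition q_closed ::
    "'a::complex_inner set \<Rightarrow> ('a \<Rightarrow> 'a \<Rightarrow> complex) \<Rightarrow> ('a \<Rightarrow> real) \<Rightarrow> bool" where
  "q_closed D \<Omega> N \<longleftrightarrow>
     (\<exists>\<alpha>>0. \<forall>\<xi>\<in>D. norm \<xi> \<le> \<alpha> * N \<xi>) \<and>
     reflexive_banach_on D N \<and>
     (\<exists>\<beta>>0. \<forall>\<xi>\<in>D. \<forall>\<eta>\<in>D. cmod (\<Omega> \<xi> \<eta>) \<le> \<beta> * N \<xi> * N \<eta>)"

definition PP ::
    "'a::complex_inner set \<Rightarrow> ('a \<Rightarrow> 'a \<Rightarrow> complex) \<Rightarrow> ('a \<Rightarrow> real) \<Rightarrow> ('a \<Rightarrow> 'a \<Rightarrow> complex) set"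
    ("\<PP>") where
  "\<PP> D \<Omega> N = {\<Upsilon>. bounded_sesquilinear \<Upsilon> \<and>
     (\<forall>\<xi>\<in>D. (\<forall>\<eta>\<in>D. \<Omega> \<xi> \<eta> + \<Upsilon> \<xi> \<eta> = 0) \<longrightarrow> \<xi> = 0) \<and>
     (\<forall>\<Lambda>\<in>conj_dual_on D N. \<exists>\<xi>\<in>D. \<forall>\<eta>\<in>D. \<Lambda> \<eta> = \<Omega> \<xi> \<eta> + \<Upsilon> \<xi> \<eta>)}"

definition solvable_wrt ::
    "'a::complex_inner set \<Rightarrow> ('a \<Rightarrow> 'a \<Rightarrow> complex) \<Rightarrow> ('a \<Rightarrow> real) \<Rightarrow> bool" where
  "solvable_wrt D \<Omega> N \<longleftrightarrow> q_closed D \<Omega> N \<and> \<PP> D \<Omega> N \<noteq> {}"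

end

theory Submission
  imports Defs
begin

text \<open>By the Riesz representation theorem a bounded form \<open>\<Upsilon>\<close> on \<open>\<H>\<close> is
  \<open>\<Upsilon>(\<xi>,\<eta>) = \<langle>B\<xi>|\<eta>\<rangle>\<close> for a linear map \<open>B\<close>. Maximality of \<open>T\<close> then follows from a conflict between
  a surjective operator and its injective extensions.

  If \<open>\<Upsilon> \<in> \<PP>(\<Omega>)\<close>, then \<open>T + B\<close> maps \<open>D(T)\<close> onto \<open>\<H>\<close>: for \<open>\<rho> \<in> \<H>\<close> the functional \<open>\<eta> \<mapsto> \<langle>\<rho>|\<eta>\<rangle>\<close> is
  bounded on \<open>\<D>[N]\<close>, because \<open>N\<close> dominates the norm of \<open>\<H>\<close>, so solvability yields \<open>\<xi> \<in> \<D>\<close> with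
  \<open>\<Omega>(\<xi>,\<eta>) = \<langle>\<rho> - B\<xi>|\<eta>\<rangle>\<close>; this says that \<open>\<xi> \<in> D(T)\<close> and \<open>T\<xi> + B\<xi> = \<rho>\<close>
  (\<open>associated_operator_perturbation_surj\<close>).

  On the other hand, if \<open>T'\<close> has numerical range in \<open>\<nn>\<close>, then \<open>T' + B\<close> is injective: a unit vector
  \<open>\<xi>\<close> in its kernel gives \<open>\<langle>T'\<xi>|\<xi>\<rangle> = -\<Upsilon>(\<xi>,\<xi>)\<close>, a point of \<open>\<nn> \<inter> (-\<nn>\<^sub>\<Upsilon>)\<close>. An injective map that
  extends a surjective one has the same domain, so \<open>T' = T\<close> (\<open>n_maximal_if_perturbation_surj\<close>).
  For the particular case, the numerical range of \<open>-\<mu>\<iota>\<close> contains no point other than \<open>-\<mu>\<close>, so its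
  negative avoids \<open>\<nn>\<close> as soon as \<open>\<mu>\<close> does.\<close>

section \<open>Complex inner product spaces\<close>

lemma cinner_add_right: "cinner x (y + z) = cinner x y + cinner x z"
  by (metis cinner_commute cinner_add_left complex_cnj_add)

lemma cinner_scaleC_right: "cinner x (a *\<^sub>C y) = cnj a * cinner x y"
  by (metis cinner_commute cinner_scaleC_left complex_cnj_mult)

lemma cinner_minus_left: "cinner (- x) y = - cinner x y"
  using cinner_scaleC_left[of "-1" x y] by simp

lemma cinner_diff_left: "cinner (x - y) z = cinner x z - cinner y z"
  using cinner_add_left[of x "- y" z] by (simp add: cinner_minus_left)

lemma cinner_diff_right: "cinner x (y - z) = cinner x y - cinner x z"
  by (metis cinner_commute cinner_diff_left complex_cnj_diff)

lemma norm_sq_eq_Re_cinner: "(norm x)\<^sup>2 = Re (cinner x x)"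
  by (simp add: cinner_self)

lemma norm_add_sq: "(norm (x + y))\<^sup>2 = (norm x)\<^sup>2 + (norm y)\<^sup>2 + 2 * Re (cinner x y)"
  using arg_cong[OF cinner_commute[of y x], of Re]
  by (simp add: norm_sq_eq_Re_cinner cinner_add_left cinner_add_right)

lemma norm_diff_sq: "(norm (x - y))\<^sup>2 = (norm x)\<^sup>2 + (norm y)\<^sup>2 - 2 * Re (cinner x y)"
  using arg_cong[OF cinner_commute[of y x], of Re]
  by (simp add: norm_sq_eq_Re_cinner cinner_diff_left cinner_diff_right)

lemma norm_scaleC: "norm (a *\<^sub>C x) = cmod a * norm x"
proof -
  have "complex_of_real ((norm (a *\<^sub>C x))\<^sup>2) = a * cnj a * complex_of_real ((norm x)\<^sup>2)"
    by (simp only: cinner_self[symmetric] cinner_scaleC_left cinner_scaleC_right mult_ac)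
  also have "\<dots> = complex_of_real ((cmod a * norm x)\<^sup>2)"
    by (simp only: complex_norm_square[symmetric] of_real_mult[symmetric] power_mult_distrib)
  finally have "(norm (a *\<^sub>C x))\<^sup>2 = (cmod a * norm x)\<^sup>2"
    by (simp only: of_real_eq_iff)
  then show ?thesis
    by (simp add: power2_eq_iff_nonneg)
qed

text \<open>Since the norm is already known to satisfy the triangle inequality, expanding
  \<open>(norm (x + y))\<^sup>2\<close> bounds the real part of the inner product; a rotation of \<open>x\<close> turns the
  real part into the modulus.\<close>

lemma Cauchy_Schwarz_cinner: "cmod (cinner x y) \<le> norm x * norm y"
proof (cases "cinner x y = 0")
  case False
  define a where "a = cnj (cinner x y) / cmod (cinner x y)"
  have "cmod a = 1"
    using False by (simp add: a_def norm_divide)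
  have "a * cinner x y = complex_of_real ((cmod (cinner x y))\<^sup>2) / cmod (cinner x y)"
    by (simp only: a_def complex_norm_square times_divide_eq_left mult.commute[of "cnj _"])
  then have "Re (a * cinner x y) = cmod (cinner x y)"
    by (simp add: power2_eq_square)
  have "(norm (a *\<^sub>C x + y))\<^sup>2 \<le> (norm (a *\<^sub>C x) + norm y)\<^sup>2"
    by (intro power_mono norm_triangle_ineq norm_ge_zero)
  then have "Re (cinner (a *\<^sub>C x) y) \<le> norm (a *\<^sub>C x) * norm y"
    by (simp add: norm_add_sq power2_sum)
  then show ?thesis
    using \<open>cmod a = 1\<close> \<open>Re (a * cinner x y) = cmod (cinner x y)\<close>
    by (simp only: cinner_scaleC_left norm_scaleC mult_1)
qed simp

section \<open>The Riesz representation theorem\<close>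

text \<open>The representing vector minimises \<open>J x = (norm x)\<^sup>2 - 2 Re (f x)\<close>: if \<open>f = cinner z\<close>, then
  \<open>J x = (norm (x - z))\<^sup>2 - (norm z)\<^sup>2\<close>. The parallelogram law makes minimising sequences Cauchy,
  so completeness provides a minimiser, at which the derivative of \<open>J\<close> in every direction
  vanishes.\<close>

lemma Riesz_representation:
  fixes f :: "'a::chilbert_space \<Rightarrow> complex"
  assumes f: "conj_linear_on UNIV f" and K: "\<And>x. cmod (f x) \<le> K * norm x"
  obtains z where "\<And>x. f x = cinner z x"
proof -
  have add: "f (x + y) = f x + f y" and scaleC: "f (a *\<^sub>C x) = cnj a * f x" for x y a
    using f by (auto simp: conj_linear_on_def)
  have scaleR: "f (r *\<^sub>R x) = r *\<^sub>R f x" for r x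
    using scaleC[of "complex_of_real r" x]
    by (simp add: scaleR_scaleC[of r x] scaleR_conv_of_real[where 'a=complex])
  have "bounded_linear f"
    using K by (intro bounded_linear_intro[of f K] add scaleR) (simp add: mult.commute)
  define J where "J x = (norm x)\<^sup>2 - 2 * Re (f x)" for x
  have J_lower: "- (K\<^sup>2) \<le> J x" for x
  proof -
    have "Re (f x) \<le> K * norm x"
      using K[of x] complex_Re_le_cmod order_trans by blast
    moreover have "0 \<le> (norm x - K)\<^sup>2"
      by simp
    ultimately show ?thesis
      by (simp add: J_def power2_diff algebra_simps)
  qed
  have bdd: "bdd_below (range J)"
    using J_lower by (auto intro!: bdd_belowI)
  define m where "m = Inf (range J)"
  have m: "m \<le> J x" for x
    unfolding m_def using bdd by (intro cInf_lower) auto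
  have parallelogram: "(norm (x - y))\<^sup>2 \<le> 2 * (J x - m) + 2 * (J y - m)" for x y
  proof -
    have "J ((1/2) *\<^sub>R (x + y)) = (norm (x + y))\<^sup>2 / 4 - (Re (f x) + Re (f y))"
      unfolding J_def scaleR add norm_scaleR
      by (simp add: power_divide add_divide_distrib)
    moreover have "(norm (x + y))\<^sup>2 + (norm (x - y))\<^sup>2 = 2 * (norm x)\<^sup>2 + 2 * (norm y)\<^sup>2"
      by (simp add: norm_add_sq norm_diff_sq)
    ultimately show ?thesis
      using m[of "(1/2) *\<^sub>R (x + y)"] J_def[of x] J_def[of y] by argo
  qed
  have "\<exists>x. J x < m + 1 / real (Suc n)" for n
  proof -
    have "Inf (range J) < m + 1 / real (Suc n)"
      by (simp add: m_def)
    then show ?thesis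
      using cInf_lessD[of "range J"] by blast
  qed
  then obtain X where X: "\<And>n. J (X n) < m + 1 / real (Suc n)"
    by metis
  have "Cauchy X"
  proof (rule CauchyI')
    fix e :: real assume "0 < e"
    then obtain M where M: "1 / real (Suc M) < e\<^sup>2 / 4"
      using reals_Archimedean[of "e\<^sup>2 / 4"] by (auto simp: inverse_eq_divide)
    have close: "J (X n) - m < e\<^sup>2 / 4" if "M \<le> n" for n
    proof -
      have "1 / real (Suc n) \<le> 1 / real (Suc M)"
        using that by (simp add: frac_le)
      then show ?thesis
        using X[of n] M by linarith
    qed
    have "(norm (X k - X n))\<^sup>2 < e\<^sup>2" if "M \<le> k" "M \<le> n" for k n
      using parallelogram[of "X k" "X n"] close[OF that(1)] close[OF that(2)] by argo
    then have "dist (X k) (X n) < e" if "M \<le> k" "k < n" for k n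
      using that \<open>0 < e\<close> power_less_imp_less_base[of "norm (X k - X n)" 2 e]
      by (simp add: dist_norm)
    then show "\<exists>M. \<forall>k\<ge>M. \<forall>n>k. dist (X k) (X n) < e"
      by blast
  qed
  then obtain z where z: "X \<longlonglongrightarrow> z"
    using Cauchy_convergent_iff convergent_def by blast
  have "(\<lambda>n. J (X n)) \<longlonglongrightarrow> J z"
    unfolding J_def by (intro tendsto_intros bounded_linear.tendsto[OF \<open>bounded_linear f\<close>] z)
  moreover have "(\<lambda>n. m + 1 / real (Suc n)) \<longlonglongrightarrow> m"
    using tendsto_add[OF tendsto_const LIMSEQ_inverse_real_of_nat] by (simp add: inverse_eq_divide)
  ultimately have "J z \<le> m"
    using X by (intro LIMSEQ_le) (auto intro: less_imp_le)
  then have minimal: "J z \<le> J x" for x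
    using m[of x] by linarith
  have Re_eq: "Re (f y) = Re (cinner z y)" for y
  proof -
    define b c where "b = (norm y)\<^sup>2" and "c = Re (cinner z y) - Re (f y)"
    have b: "0 \<le> b"
      by (simp add: b_def)
    have J_line: "J (z + t *\<^sub>R y) = J z + (t\<^sup>2 * b + 2 * t * c)" for t
      unfolding J_def norm_add_sq add scaleR b_def c_def
      by (simp add: scaleR_scaleC[of t y] norm_scaleC cinner_scaleC_right power_mult_distrib algebra_simps)
    \<comment> \<open>The step \<open>- c / b\<close> would be optimal; the increment of the denominator covers \<open>b = 0\<close>.\<close>
    define t where "t = - c / (b + 1)"
    have "0 \<le> t\<^sup>2 * b + 2 * t * c"
      using minimal[of "z + t *\<^sub>R y"] by (simp add: J_line)
    moreover have "c = - (t * (b + 1))"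
      using b by (simp add: t_def)
    ultimately have "t\<^sup>2 * (b + 2) \<le> 0"
      by (simp add: algebra_simps power2_eq_square)
    then have "t = 0"
      using b by (simp add: mult_le_0_iff)
    then show ?thesis
      using \<open>c = - (t * (b + 1))\<close> by (simp add: c_def)
  qed
  have "f x = cinner z x" for x
  proof (rule complex_eqI)
    show "Re (f x) = Re (cinner z x)"
      by (rule Re_eq)
    show "Im (f x) = Im (cinner z x)"
      using Re_eq[of "\<i> *\<^sub>C x"] by (simp add: scaleC cinner_scaleC_right)
  qed
  then show ?thesis
    using that by blast
qed

lemma cinner_eq_on_dense:
  assumes D: "closure D = UNIV" and eq: "\<And>\<eta>. \<eta> \<in> D \<Longrightarrow> cinner x \<eta> = cinner y \<eta>"
  shows "x = y"
proof -
  have cont: "bounded_linear (\<lambda>\<eta>. cinner (x - y) \<eta>)"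
  proof (rule bounded_linear_intro[where K = "norm (x - y)"])
    show "cinner (x - y) (r *\<^sub>R \<eta>) = r *\<^sub>R cinner (x - y) \<eta>" for r \<eta>
      by (simp add: scaleR_scaleC[of r \<eta>] cinner_scaleC_right scaleR_conv_of_real[where 'a=complex])
    show "cmod (cinner (x - y) \<eta>) \<le> norm \<eta> * norm (x - y)" for \<eta>
      using Cauchy_Schwarz_cinner[of "x - y" \<eta>] by (simp only: mult.commute)
  qed (rule cinner_add_right)
  have "x - y \<in> closure D"
    using D by simp
  then obtain X where X: "\<And>n. X n \<in> D" "X \<longlonglongrightarrow> x - y"
    by (auto simp: closure_sequential)
  have "(\<lambda>n. cinner (x - y) (X n)) \<longlonglongrightarrow> cinner (x - y) (x - y)"
    by (rule bounded_linear.tendsto[OF cont X(2)])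
  moreover have "cinner (x - y) (X n) = 0" for n
    using eq[OF X(1)] by (simp add: cinner_diff_left)
  ultimately have "cinner (x - y) (x - y) = 0"
    by (simp add: LIMSEQ_const_iff)
  then show ?thesis
    by (simp add: cinner_self)
qed

text \<open>Riesz representation in the second argument; linearity of \<open>B\<close> comes from the uniqueness of
  the representing vectors.\<close>

lemma bounded_sesquilinear_represented:
  fixes \<Upsilon> :: "'a::chilbert_space \<Rightarrow> 'a \<Rightarrow> complex"
  assumes "bounded_sesquilinear \<Upsilon>"
  obtains B where "clinear_on UNIV B" "\<And>\<xi> \<eta>. \<Upsilon> \<xi> \<eta> = cinner (B \<xi>) \<eta>"
proof -
  obtain K where lin: "\<And>\<eta>. clinear_on UNIV (\<lambda>\<xi>. \<Upsilon> \<xi> \<eta>)"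
    and clin: "\<And>\<xi>. conj_linear_on UNIV (\<Upsilon> \<xi>)"
    and K: "\<And>\<xi> \<eta>. cmod (\<Upsilon> \<xi> \<eta>) \<le> K * norm \<xi> * norm \<eta>"
    using assms unfolding bounded_sesquilinear_def sesquilinear_on_def by auto
  have "\<exists>z. \<forall>\<eta>. \<Upsilon> \<xi> \<eta> = cinner z \<eta>" for \<xi>
    using Riesz_representation[OF clin K] by metis
  then obtain B where B: "\<And>\<xi> \<eta>. \<Upsilon> \<xi> \<eta> = cinner (B \<xi>) \<eta>"
    by metis
  have "B (x + y) = B x + B y" for x y
    by (rule cinner_eq_on_dense[of UNIV])
      (use lin in \<open>simp_all add: clinear_on_def B cinner_add_left\<close>)
  moreover have "B (a *\<^sub>C x) = a *\<^sub>C B x" for a x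
    by (rule cinner_eq_on_dense[of UNIV])
      (use lin in \<open>simp_all add: clinear_on_def B cinner_scaleC_left scaleC_complex_def\<close>)
  ultimately show ?thesis
    using B by (intro that[of B]) (simp_all add: clinear_on_def)
qed

section \<open>The operator associated with a form\<close>

lemma associated_operator_eq_Some_iff:
  assumes "closure D = UNIV"
  shows "associated_operator D \<Omega> \<xi> = Some \<zeta> \<longleftrightarrow> \<xi> \<in> D \<and> (\<forall>\<eta>\<in>D. \<Omega> \<xi> \<eta> = cinner \<zeta> \<eta>)"
proof -
  have "(THE \<zeta>. \<forall>\<eta>\<in>D. \<Omega> \<xi> \<eta> = cinner \<zeta> \<eta>) = \<rho>" if "\<forall>\<eta>\<in>D. \<Omega> \<xi> \<eta> = cinner \<rho> \<eta>" for \<rho>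
    using that by (intro the_equality) (auto intro: cinner_eq_on_dense[OF assms])
  then show ?thesis
    unfolding associated_operator_def by auto
qed

lemma is_operator_associated_operator:
  assumes D: "complex_vector.subspace D" and dense: "closure D = UNIV"
    and \<Omega>: "sesquilinear_on D \<Omega>"
  shows "is_operator (associated_operator D \<Omega>)"
proof -
  let ?T = "associated_operator D \<Omega>"
  note iff = associated_operator_eq_Some_iff[OF dense]
  have \<Omega>_add: "\<Omega> (x + y) \<eta> = \<Omega> x \<eta> + \<Omega> y \<eta>" and \<Omega>_scaleC: "\<Omega> (a *\<^sub>C x) \<eta> = a * \<Omega> x \<eta>"
    if "x \<in> D" "y \<in> D" "\<eta> \<in> D" for x y \<eta> a
    using \<Omega> that by (auto simp: sesquilinear_on_def clinear_on_def scaleC_complex_def)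
  have add: "?T (x + y) = Some (\<zeta> + \<rho>)" if "?T x = Some \<zeta>" "?T y = Some \<rho>" for x y \<zeta> \<rho>
    using that D by (simp add: iff complex_vector.subspace_add \<Omega>_add cinner_add_left)
  have scaleC: "?T (a *\<^sub>C x) = Some (a *\<^sub>C \<zeta>)" if "?T x = Some \<zeta>" for a x \<zeta>
    using that D by (auto simp: iff complex_vector.subspace_scale \<Omega>_scaleC cinner_scaleC_left)
  have zero: "?T 0 = Some 0"
  proof -
    have "0 \<in> D"
      using D by (rule complex_vector.subspace_0)
    moreover have "\<Omega> 0 \<eta> = cinner 0 \<eta>" if "\<eta> \<in> D" for \<eta>
      using \<Omega>_scaleC[OF \<open>0 \<in> D\<close> that that, of 0] cinner_scaleC_left[of 0 0 \<eta>] by simp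
    ultimately show ?thesis
      by (simp add: iff)
  qed
  show ?thesis
    unfolding is_operator_def clinear_on_def
    by (auto simp: dom_def add scaleC zero intro!: complex_vector.subspaceI)
qed

lemma op_num_range_associated_operator:
  assumes "closure D = UNIV"
  shows "op_num_range (associated_operator D \<Omega>) \<subseteq> form_num_range D \<Omega>"
proof
  fix w assume "w \<in> op_num_range (associated_operator D \<Omega>)"
  then obtain \<xi> \<zeta> where "associated_operator D \<Omega> \<xi> = Some \<zeta>" "w = cinner \<zeta> \<xi>" "norm \<xi> = 1"
    unfolding op_num_range_def by auto
  then show "w \<in> form_num_range D \<Omega>"
    unfolding form_num_range_def associated_operator_eq_Some_iff[OF assms] by force
qed

text \<open>The functional \<open>cinner \<rho>\<close> belongs to the conjugate dual of \<open>D[N]\<close> because \<open>N\<close> dominates the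
  norm. Solving \<open>\<Omega> + \<Upsilon>\<close> against it gives a vector \<open>\<xi>\<close> for which \<open>\<Omega> \<xi>\<close> is represented by
  \<open>\<rho> - B \<xi>\<close>, hence a vector of the domain of the associated operator.\<close>

lemma associated_operator_perturbation_surj:
  assumes dense: "closure D = UNIV" and q: "q_closed D \<Omega> N" and \<Upsilon>: "\<Upsilon> \<in> \<PP> D \<Omega> N"
    and B: "\<And>\<xi> \<eta>. \<Upsilon> \<xi> \<eta> = cinner (B \<xi>) \<eta>"
  shows "\<exists>\<xi>. associated_operator D \<Omega> \<xi> = Some (\<rho> - B \<xi>)"
proof -
  obtain \<alpha> where \<alpha>: "\<And>\<xi>. \<xi> \<in> D \<Longrightarrow> norm \<xi> \<le> \<alpha> * N \<xi>"
    using q by (auto simp: q_closed_def)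
  have D: "complex_vector.subspace D"
    using q by (simp add: q_closed_def reflexive_banach_on_def banach_on_def)
  define \<Lambda> where "\<Lambda> \<eta> = (if \<eta> \<in> D then cinner \<rho> \<eta> else 0)" for \<eta>
  have "cmod (\<Lambda> \<eta>) \<le> (norm \<rho> * \<alpha>) * N \<eta>" if "\<eta> \<in> D" for \<eta>
  proof -
    have "cmod (\<Lambda> \<eta>) \<le> norm \<rho> * norm \<eta>"
      using that by (simp add: \<Lambda>_def Cauchy_Schwarz_cinner)
    also have "\<dots> \<le> norm \<rho> * (\<alpha> * N \<eta>)"
      by (intro mult_left_mono \<alpha> that norm_ge_zero)
    finally show ?thesis
      by (simp add: mult.assoc)
  qed
  then have "bounded_on D N \<Lambda>"
    unfolding bounded_on_def by blast
  moreover have "conj_linear_on D \<Lambda>"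
    using D by (simp add: conj_linear_on_def \<Lambda>_def complex_vector.subspace_add
        complex_vector.subspace_scale cinner_add_right cinner_scaleC_right)
  ultimately have "\<Lambda> \<in> conj_dual_on D N"
    by (simp add: conj_dual_on_def \<Lambda>_def)
  then obtain \<xi> where "\<xi> \<in> D" and \<xi>: "\<And>\<eta>. \<eta> \<in> D \<Longrightarrow> \<Lambda> \<eta> = \<Omega> \<xi> \<eta> + \<Upsilon> \<xi> \<eta>"
    using \<Upsilon> unfolding PP_def mem_Collect_eq by metis
  have "\<Omega> \<xi> \<eta> = cinner (\<rho> - B \<xi>) \<eta>" if "\<eta> \<in> D" for \<eta>
    using \<xi>[OF that] that by (simp add: \<Lambda>_def B cinner_diff_left)
  then show ?thesis
    using \<open>\<xi> \<in> D\<close> by (auto simp: associated_operator_eq_Some_iff[OF dense])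
qed

section \<open>Maximality\<close>

text \<open>For an extension \<open>T'\<close> of \<open>T\<close> with numerical range in \<open>\<nn>\<close>, normalising a nonzero vector in
  the kernel of \<open>T' + B\<close> would produce a value of \<open>\<langle>T'\<xi>|\<xi>\<rangle>\<close> equal to \<open>- \<langle>B\<xi>|\<xi>\<rangle>\<close>. So \<open>T' + B\<close> is
  injective, and it cannot properly extend the surjective \<open>T + B\<close>.\<close>

lemma n_maximal_if_perturbation_surj:
  assumes T: "is_operator T" "op_num_range T \<subseteq> \<nn>"
    and B: "clinear_on UNIV B"
    and disjoint: "\<And>\<xi>. norm \<xi> = 1 \<Longrightarrow> - cinner (B \<xi>) \<xi> \<notin> \<nn>"
    and surj: "\<And>\<rho>. \<exists>\<xi>. T \<xi> = Some (\<rho> - B \<xi>)"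
  shows "n_maximal \<nn> T"
proof -
  have B_scaleC: "B (a *\<^sub>C x) = a *\<^sub>C B x" and B_add: "B (x + y) = B x + B y" for a x y
    using B by (simp_all add: clinear_on_def)
  have B_diff: "B (x - y) = B x - B y" for x y
    using B_add[of "x - y" y] by simp
  have "T = T'" if T': "is_operator T'" and ext: "T \<subseteq>\<^sub>m T'" and nr: "op_num_range T' \<subseteq> \<nn>" for T'
  proof -
    have sub: "complex_vector.subspace (dom T')"
      and T'_add: "\<And>x y. x \<in> dom T' \<Longrightarrow> y \<in> dom T' \<Longrightarrow> the (T' (x + y)) = the (T' x) + the (T' y)"
      and T'_scaleC: "\<And>a x. x \<in> dom T' \<Longrightarrow> the (T' (a *\<^sub>C x)) = a *\<^sub>C the (T' x)"
      using T' by (auto simp: is_operator_def clinear_on_def)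
    have T'_diff: "the (T' (x - y)) = the (T' x) - the (T' y)" if "x \<in> dom T'" "y \<in> dom T'" for x y
      using T'_add[OF complex_vector.subspace_diff[OF sub that] that(2)] by (simp add: algebra_simps)
    have injective: "x = 0" if x: "x \<in> dom T'" "the (T' x) = - B x" for x
    proof (rule ccontr)
      assume "x \<noteq> 0"
      define u where "u = complex_of_real (1 / norm x) *\<^sub>C x"
      have u: "u \<in> dom T'" "norm u = 1"
        using complex_vector.subspace_scale[OF sub x(1)] \<open>x \<noteq> 0\<close>
        by (simp_all add: u_def norm_scaleC norm_divide)
      have "the (T' u) = - B u"
        using x by (simp add: u_def T'_scaleC B_scaleC)
      then have "- cinner (B u) u \<in> op_num_range T'"
        unfolding op_num_range_def using u cinner_minus_left[of "B u" u] by force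
      then show False
        using nr disjoint[OF u(2)] by blast
    qed
    have "T x = T' x" if x: "x \<in> dom T'" for x
    proof -
      obtain y where y: "T y = Some ((the (T' x) + B x) - B y)"
        using surj by blast
      then have y': "T' y = T y" "y \<in> dom T'"
        using ext by (auto simp: map_le_def dom_def)
      have "x - y = 0"
        using complex_vector.subspace_diff[OF sub x y'(2)]
        by (rule injective) (simp add: T'_diff[OF x y'(2)] y'(1) y B_diff)
      then show ?thesis
        using y'(1) by simp
    qed
    moreover have "T x = T' x" if "x \<notin> dom T'" for x
      using ext that by (metis domIff map_le_def)
    ultimately show ?thesis
      by blast
  qed
  then show ?thesis
    using T by (auto simp: n_maximal_def)
qed

theorem theorem8p3:
  fixes \<nn> :: "complex set"
    and D :: "'a::chilbert_space set"
    and \<Omega> :: "'a \<Rightarrow> 'a \<Rightarrow> complex"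
    and N :: "'a \<Rightarrow> real"
  assumes "\<nn> \<noteq> {}" and "\<nn> \<noteq> UNIV" and "convex \<nn>"
    and "complex_vector.subspace D" and "closure D = UNIV"
    and "sesquilinear_on D \<Omega>"
    and "solvable_wrt D \<Omega> N"
    and "form_num_range D \<Omega> \<subseteq> \<nn>"
  shows "(\<forall>\<Upsilon>\<in>\<PP> D \<Omega> N. \<nn> \<inter> uminus ` form_num_range UNIV \<Upsilon> = {}
            \<longrightarrow> n_maximal \<nn> (associated_operator D \<Omega>)) \<and>
         ((\<exists>\<mu>\<in>- \<nn>. (\<lambda>\<xi> \<eta>. - \<mu> * cinner \<xi> \<eta>) \<in> \<PP> D \<Omega> N)
            \<longrightarrow> n_maximal \<nn> (associated_operator D \<Omega>))"
proof -
  have main: "n_maximal \<nn> (associated_operator D \<Omega>)"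
    if \<Upsilon>: "\<Upsilon> \<in> \<PP> D \<Omega> N" and disjoint: "\<nn> \<inter> uminus ` form_num_range UNIV \<Upsilon> = {}" for \<Upsilon>
  proof -
    have "bounded_sesquilinear \<Upsilon>"
      using \<Upsilon> by (simp add: PP_def)
    then obtain B where B: "clinear_on UNIV B" "\<And>\<xi> \<eta>. \<Upsilon> \<xi> \<eta> = cinner (B \<xi>) \<eta>"
      by (rule bounded_sesquilinear_represented) blast
    show ?thesis
    proof (rule n_maximal_if_perturbation_surj[OF _ _ B(1)])
      show "is_operator (associated_operator D \<Omega>)"
        using assms by (intro is_operator_associated_operator)
      show "op_num_range (associated_operator D \<Omega>) \<subseteq> \<nn>"
        using op_num_range_associated_operator assms by blast
      show "- cinner (B \<xi>) \<xi> \<notin> \<nn>" if "norm \<xi> = 1" for \<xi>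
        using disjoint that by (auto simp: form_num_range_def B(2))
      show "\<exists>\<xi>. associated_operator D \<Omega> \<xi> = Some (\<rho> - B \<xi>)" for \<rho>
        using assms \<Upsilon> B(2) unfolding solvable_wrt_def
        by (blast intro: associated_operator_perturbation_surj)
    qed
  qed
  moreover have "\<nn> \<inter> uminus ` form_num_range UNIV (\<lambda>\<xi> \<eta> :: 'a. - \<mu> * cinner \<xi> \<eta>) = {}"
    if "\<mu> \<in> - \<nn>" for \<mu>
    using that by (auto simp: form_num_range_def cinner_self)
  ultimately show ?thesis
    by blast
qed

end
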